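(* For every natural number $k$, there exists an abstract provability structure $S$ such that $\mathsf{E}_S(\boxtimes\Box^{k+1})$ holds but $\mathsf{E}_S(\boxtimes\Box^k)$ does not hold.
   Context: An abstract provability structure (APS) is a tuple $S=\langle L,\leq,\top,\bot,\Box,\boxtimes\rangle$ where $L$ is a nonempty set, $\leq$ is a partial order on $L$, $\top,\bot\in L$, and $\Box,\boxtimes$ are unary operations on $L$ such that for all $x,y\in L$: (C1) if $x\leq y$ then $\Box x\leq\Box y$ and $\boxtimes y\leq\boxtimes x$; (C2) $\top\leq\boxtimes\bot$; (C3) if $x\leq\Box y$ and $x\leq\boxtimes y$ then $x\leq\boxtimes\top$; (C4) $\boxtimes x\leq\Box\boxtimes x$; (C5) $x\leq\top$. (It is not assumed that $\bot$ is the least element.) A one-variable APS term $\triangle v$ is generated from the variable $v$ by finitely many applications of $\Box$ and $\boxtimes$; it induces a unary operation $x\mapsto\triangle x$ on $L$. Compositions are written by concatenation, and $\Box^n$ is the $n$-fold iterate of $\Box$. Natural numbers include $0$. $\mathsf{E}_S(\triangle)$ means "$\triangle v$ has a fixed point in $S$", i.e. there is $p\in L$ with $\triangle p=p$. *)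

theory Defs
  imports Main
begin

record 'a prov_structure =
  car  :: "'a set"
  leq  :: "('a \<times> 'a) set"
  tp   :: 'a
  bt   :: 'a
  box  :: "'a \<Rightarrow> 'a"
  tbox :: "'a \<Rightarrow> 'a"

text \<open>The operation \<open>\<box>\<close> is \<open>box\<close> and \<open>\<boxtimes>\<close> is \<open>tbox\<close>; only their values on the carrier matter.
  The element \<open>bt\<close> is not assumed to be the least one.\<close>

locale abstract_provability_structure =
  fixes S :: "'a prov_structure"
  assumes nonempty: "car S \<noteq> {}"
    and order: "partial_order_on (car S) (leq S)"
    and tp_closed: "tp S \<in> car S"
    and bt_closed: "bt S \<in> car S"
    and box_closed: "x \<in> car S \<Longrightarrow> box S x \<in> car S"
    and tbox_closed: "x \<in> car S \<Longrightarrow> tbox S x \<in> car S"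
    and C1_box: "x \<in> car S \<Longrightarrow> y \<in> car S \<Longrightarrow> (x, y) \<in> leq S \<Longrightarrow> (box S x, box S y) \<in> leq S"
    and C1_tbox: "x \<in> car S \<Longrightarrow> y \<in> car S \<Longrightarrow> (x, y) \<in> leq S \<Longrightarrow> (tbox S y, tbox S x) \<in> leq S"
    and C2: "(tp S, tbox S (bt S)) \<in> leq S"
    and C3: "x \<in> car S \<Longrightarrow> y \<in> car S \<Longrightarrow> (x, box S y) \<in> leq S \<Longrightarrow> (x, tbox S y) \<in> leq S
      \<Longrightarrow> (x, tbox S (tp S)) \<in> leq S"
    and C4: "x \<in> car S \<Longrightarrow> (tbox S x, box S (tbox S x)) \<in> leq S"
    and C5: "x \<in> car S \<Longrightarrow> (x, tp S) \<in> leq S"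

datatype aps_term = Var | Box aps_term | TBox aps_term

primrec eval_term :: "'a prov_structure \<Rightarrow> aps_term \<Rightarrow> 'a \<Rightarrow> 'a" where
  "eval_term S Var x = x"
| "eval_term S (Box t) x = box S (eval_term S t x)"
| "eval_term S (TBox t) x = tbox S (eval_term S t x)"

definition has_fixed_point :: "'a prov_structure \<Rightarrow> aps_term \<Rightarrow> bool" where
  "has_fixed_point S t \<longleftrightarrow> (\<exists>p\<in>car S. eval_term S t p = p)"

end

theory Submission
  imports Defs
begin

text \<open>A fixed point \<open>p\<close> of \<open>\<boxtimes>\<box>\<^sup>n\<close> satisfies \<open>p \<le> \<box>p\<close> and \<open>p \<le> \<boxtimes>p\<close>, so (C3) forces \<open>p = \<boxtimes>\<top>\<close>.
  Hence it suffices to make \<open>\<boxtimes>\<box>\<^sup>ip\<close> drop to \<open>\<boxtimes>\<top>\<close> exactly at \<open>i = k + 1\<close>. Take a chain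
  \<open>\<bottom> < p\<^sub>0 < \<dots> < p\<^bsub>k+1\<^esub> < \<top>\<close> on which \<open>\<box>\<close> shifts \<open>p\<^sub>i\<close> to \<open>p\<^bsub>i+1\<^esub>\<close>, together with an element
  \<open>p\<^sub>0 < q < \<top>\<close> incomparable to \<open>p\<^sub>1, \<dots>, p\<^bsub>k+1\<^esub>\<close>, and let \<open>\<boxtimes>\<close> send \<open>\<bottom>\<close> to \<open>\<top>\<close>, the elements
  \<open>p\<^sub>0, \<dots>, p\<^sub>k\<close> to \<open>q\<close>, and everything else to \<open>p\<^sub>0\<close>.\<close>

text \<open>Encoding: \<open>\<bottom>\<close> is \<open>0\<close>, \<open>p\<^sub>i\<close> is \<open>i + 1\<close>, \<open>\<top>\<close> is \<open>k + 3\<close> and \<open>q\<close> is \<open>k + 4\<close>.\<close>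

definition shift_structure :: "nat \<Rightarrow> nat prov_structure" where
  "shift_structure k = \<lparr>
     car = {..k + 4},
     leq = {(x, y). x \<le> k + 4 \<and> y \<le> k + 4 \<and>
       (x = y \<or> y = k + 3 \<or> x \<le> y \<and> (x \<le> 1 \<or> y \<le> k + 2))},
     tp = k + 3,
     bt = 0,
     box = (\<lambda>x. if x = 0 then 0 else if x \<le> k + 1 then x + 1
       else if x = k + 2 then k + 2 else k + 3),
     tbox = (\<lambda>x. if x = 0 then k + 3 else if x \<le> k + 1 then k + 4 else 1)\<rparr>"

text \<open>(C3) rests on \<open>q\<close>: when \<boxtimes> gives \<open>q\<close>, \<box> gives
  some \<open>p\<^sub>j\<close> with \<open>j > 0\<close>, and incomparability leaves only \<bottom>
  and \<open>p\<^sub>0\<close> = \<boxtimes>\<top> below both.\<close>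

lemma abstract_provability_structure_shift_structure:
  "abstract_provability_structure (shift_structure k)"
proof
  show "partial_order_on (car (shift_structure k)) (leq (shift_structure k))"
    unfolding partial_order_on_def preorder_on_def
    by (auto simp: shift_structure_def intro!: refl_onI transI antisymI)
qed (auto simp: shift_structure_def split: if_splits)

lemma eval_term_Box_funpow: "eval_term S ((Box ^^ n) t) x = (box S ^^ n) (eval_term S t x)"
  by (induction n) simp_all

lemma box_funpow_chain:
  "n \<le> k + 1 \<Longrightarrow> (box (shift_structure k) ^^ n) 1 = n + 1"
  by (induction n) (auto simp: shift_structure_def)

lemma box_funpow_ge:
  "x \<ge> k + 3 \<Longrightarrow> (box (shift_structure k) ^^ n) x \<ge> k + 3"
  by (induction n) (auto simp: shift_structure_def)

text \<open>A fixed point lies in the range of \<boxtimes>, so only \<open>p\<^sub>0\<close>, \<top>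
  and \<open>q\<close> are candidates.\<close>

lemma tbox_shift_structure_cases:
  "tbox (shift_structure k) x = 1 \<or> tbox (shift_structure k) x \<ge> k + 3"
  by (simp add: shift_structure_def)

theorem proposition5p3:
  fixes k :: nat
  shows "\<exists>S :: nat prov_structure. abstract_provability_structure S
    \<and> has_fixed_point S (TBox ((Box ^^ (k + 1)) Var))
    \<and> \<not> has_fixed_point S (TBox ((Box ^^ k) Var))"
proof (intro exI conjI)
  let ?S = "shift_structure k"
  show "abstract_provability_structure ?S"
    by (rule abstract_provability_structure_shift_structure)
  \<comment> \<open>From \<open>p\<^sub>0\<close>, \<open>k + 1\<close> shifts just reach the one
    chain element above \<bottom> that \<boxtimes> returns to \<open>p\<^sub>0\<close>.\<close>
  have "tbox ?S ((box ?S ^^ (k + 1)) 1) = 1"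
    unfolding box_funpow_chain[OF order_refl] by (simp add: shift_structure_def)
  moreover have "1 \<in> car ?S"
    by (simp add: shift_structure_def)
  ultimately show "has_fixed_point ?S (TBox ((Box ^^ (k + 1)) Var))"
    unfolding has_fixed_point_def eval_term.simps eval_term_Box_funpow by blast
  show "\<not> has_fixed_point ?S (TBox ((Box ^^ k) Var))"
  proof
    assume "has_fixed_point ?S (TBox ((Box ^^ k) Var))"
    then obtain p where p: "tbox ?S ((box ?S ^^ k) p) = p"
      unfolding has_fixed_point_def eval_term.simps eval_term_Box_funpow by blast
    then consider "p = 1" | "p \<ge> k + 3"
      using tbox_shift_structure_cases by metis
    then show False
    proof cases
      case 1
      \<comment> \<open>One shift fewer stops where \<boxtimes> still gives
        \<open>q\<close>.\<close>
      have "(box ?S ^^ k) p = k + 1"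
        unfolding 1 by (rule box_funpow_chain) simp
      with p 1 show False
        by (simp add: shift_structure_def)
    next
      case 2
      then have "(box ?S ^^ k) p \<ge> k + 3"
        by (rule box_funpow_ge)
      then have "tbox ?S ((box ?S ^^ k) p) = 1"
        by (simp add: shift_structure_def)
      with p 2 show False
        by simp
    qed
  qed
qed

end
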